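(* In the setting described in the context (soft interventions), suppose that: (A1) there is one observational environment and there are $n$ interventional environments, in each of which exactly one node is intervened, and each node is intervened in exactly one of them; (A2) for every $i\in[n]$ and every $k\in\mathrm{pa}(i)$, the function $(z_i,z_{\mathrm{pa}(i)})\mapsto \frac{\partial}{\partial z_k}\frac{q_Z(z_i\mid z_{\mathrm{pa}(i)})}{p_Z(z_i\mid z_{\mathrm{pa}(i)})}$ is not identically zero; (A3) for every $i\in[n]$ and every $c\in\mathcal C_i=\{c\in\mathbb R^n:\exists j\in\overline{\mathrm{pa}}(i),\ c_j\neq 0\}$, it is not the case that $c^\top s_Z(Z)=c^\top s_Z^{m_i}(Z)$ almost surely under $Z\sim p_Z$. Let $\hat T$ be an arbitrary element of $\mathcal U_{\rm S}$, let $\hat Z=\hat T^{+}X$, and let $\mathcal G_{\hat Z}$ be the directed graph on $[n]$ constructed from $K(\hat T)$. Then there is a valid causal order $\pi$ of $\mathcal G_Z$ such that: 1. $\mathcal G_{\hat Z}$ is a DAG equal to $\mathcal G_Z$ up to the relabelling $\pi$, i.e. $j\to i$ is an edge of $\mathcal G_{\hat Z}$ if and only if $\pi_j\to\pi_i$ is an edge of $\mathcal G_Z$, and the distribution of $\hat Z$ factorizes with respect to $\mathcal G_{\hat Z}$. 2. $\hat Z$ satisfies mixing consistency: there are a constant diagonal matrix $C\in\mathbb R^{n\times n}$ and a constant matrix $B\in\mathbb R^{n\times n}$ with $B_{i,j}=0$ whenever $j\notin\mathrm{sur}(i)$, for all $i,j\in[n]$, such that for every realization of $Z$ and its associated estimate,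 $$\hat Z=P_\pi\,(C+B)\,Z .$$
   Context: Notation: $[n]=\{1,\dots,n\}$; $\Pi$ is the set of $n\times n$ permutation matrices; $\|A\|_0$ is the number of nonzero entries of $A$; $\mathrm{im}(A)$ is the column space; $U^{+}=(U^\top U)^{-1}U^\top$ for full-column-rank $U$; $I_n$ is the identity matrix. Setting. Let $d\ge n$ and $T\in\mathbb R^{d\times n}$ with $\mathrm{rank}(T)=n$. $Z=(Z_1,\dots,Z_n)^\top$ is a latent random vector with density $p_Z$ on $\mathbb R^n$, $p_Z(z)\neq0$ for all $z$, which factorizes along a DAG $\mathcal G_Z$ on $[n]$: $p_Z(z)=\prod_{i=1}^n p_Z(z_i\mid z_{\mathrm{pa}(i)})$. Here $\mathrm{pa}(i)$, $\mathrm{ch}(i)$ are the parents and children of $i$ in $\mathcal G_Z$, $\overline{\mathrm{pa}}(i)=\mathrm{pa}(i)\cup\{i\}$, $\overline{\mathrm{ch}}(i)=\mathrm{ch}(i)\cup\{i\}$. Nodes are labelled so that $i\in\mathrm{pa}(j)$ implies $i<j$. The observed vector is $X=TZ$. For each $i$ there is also an interventional conditional density $q_Z(z_i\mid z_{\mathrm{pa}(i)})$ different from $p_Z(z_i\mid z_{\mathrm{pa}(i)})$. All these conditional densities are positive and continuously differentiable in all variables. Environments. In the observational environment, $Z\sim p_Z$. Under (A1) there is a bijection $i\mapsto m_i$ of $[n]$ such that in interventional environment $m_i$ exactly node $i$ is intervened and (soft intervention) the latent density is $p^{m_i}(z)=q_Z(z_i\mid z_{\mathrm{pa}(i)})\prod_{j\ne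 i}p_Z(z_j\mid z_{\mathrm{pa}(j)})$; $X=TZ$ in every environment with the same $T$. Scores. $s_Z=\nabla_z\log p_Z$, $s_Z^m=\nabla_z\log p^m$. $s_X$ and $s_X^m$ are the gradients of the log-densities of $X$ in the observational environment and in environment $m$ (densities with respect to $n$-dimensional Lebesgue measure on $\mathrm{im}(T)$, gradients taken along $\mathrm{im}(T)$). These scores, and whether coordinates of score functions agree almost surely, are assumed to be known exactly. Candidate transformations. $\mathcal U=\{U\in\mathbb R^{d\times n}:\mathrm{rank}(U)=n,\ UU^{+}x=x\ \forall x\in\mathrm{im}(T)\}$. For $A'\in\mathbb R^{n\times d}$ let $\Delta_X(A')\in\{0,1\}^{n\times n}$ have $(i,m)$ entry $0$ if $[A's_X(X)]_i=[A's_X^m(X)]_i$ almost surely under the observational law of $X$, and $1$ otherwise. Define $\mathcal U_1=\{V\in\mathcal U:\|\Delta_X(V^\top)\|_0=\min_{U\in\mathcal U}\|\Delta_X(U^\top)\|_0\}$ and $\mathcal U_{\rm S}=\{U\in\mathcal U_1:\exists P\in\Pi$ such that $\Delta_X(U^\top)P$ is upper triangular$\}$. For $U\in\mathcal U_{\rm S}$, $P_2(U)$ denotes a permutation matrix making $K(U):=\Delta_X(U^\top)P_2(U)$ upper triangular. The graph $\mathcal G_{\hat Z}$ constructed from $K(\hat T)$ has node set $[n]$ and an edge $j\to i$ ($j\neq i$) exactly when $[K(\hat T)]_{j,i}=1$. Valid causal order: a permutation $\pi=(\pi_1,\dots,\pi_n)$ of $[n]$ such that $\pi_i\in\mathrm{pa}(\pi_j)$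 implies $i<j$. $P_\pi$ is the permutation matrix with $P_\pi(1,\dots,n)^\top=(\pi_1,\dots,\pi_n)^\top$. Surrounding: $\mathrm{sur}(i)=\{j\in[n]:j\ne i,\ \overline{\mathrm{ch}}(i)\subseteq\mathrm{ch}(j)\}$. *)

theory Defs
  imports "HOL-Probability.Probability"
begin

(* Index set [n]: a type 'n :: {finite, wellorder} with CARD('n) = n.
   A d x n matrix has type real^'n^'d. *)

section \<open>Matrices\<close>

abbreviation im :: "real^'n^'d \<Rightarrow> (real^'d) set" where
  "im A \<equiv> range (\<lambda>z. A *v z)"

text \<open>Only meaningful for matrices of full column rank.\<close>
definition pinv :: "real^'n^'d \<Rightarrow> real^'d^'n" where
  "pinv U = matrix_inv (transpose U ** U) ** transpose U"

definition norm0 :: "real^'m^'k \<Rightarrow> nat" where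
  "norm0 A = card {(i, j). A $ i $ j \<noteq> 0}"

definition upper_triangular :: "real^'n::{finite,wellorder}^'n::{finite,wellorder} \<Rightarrow> bool" where
  "upper_triangular A \<longleftrightarrow> (\<forall>i j. j < i \<longrightarrow> A $ i $ j = 0)"

definition diagonal_matrix :: "real^'n^'n \<Rightarrow> bool" where
  "diagonal_matrix A \<longleftrightarrow> (\<forall>i j. i \<noteq> j \<longrightarrow> A $ i $ j = 0)"

definition perm_matrix :: "('n \<Rightarrow> 'n) \<Rightarrow> real^'n^'n" where
  "perm_matrix \<pi> = (\<chi> i j. if j = \<pi> i then 1 else 0)"

lemma perm_matrix_mult_vec: "(perm_matrix \<pi> *v z) $ i = z $ \<pi> i"
  by (simp add: perm_matrix_def matrix_vector_mult_def if_distrib[of "\<lambda>x. x * _"] cong: if_cong)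

definition perm_matrices :: "(real^'n^'n) set" where
  "perm_matrices = {perm_matrix \<pi> | \<pi>. bij \<pi>}"

section \<open>Directed graphs on the index set\<close>

text \<open>A graph is its set of edges; \<open>(i, j)\<close> is the edge from \<open>i\<close> to \<open>j\<close>,
  and a DAG is a graph satisfying the library predicate \<open>acyclic\<close>.\<close>

definition pa :: "('n \<times> 'n) set \<Rightarrow> 'n \<Rightarrow> 'n set" where
  "pa G i = {j. (j, i) \<in> G}"

definition ch :: "('n \<times> 'n) set \<Rightarrow> 'n \<Rightarrow> 'n set" where
  "ch G i = {j. (i, j) \<in> G}"

definition sur :: "('n \<times> 'n) set \<Rightarrow> 'n \<Rightarrow> 'n set" where
  "sur G i = {j. j \<noteq> i \<and> insert i (ch G i) \<subseteq> ch G j}"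

definition valid_causal_order :: "('n \<times> 'n) set \<Rightarrow> ('n::wellorder \<Rightarrow> 'n) \<Rightarrow> bool" where
  "valid_causal_order G \<pi> \<longleftrightarrow> bij \<pi> \<and> (\<forall>i j. \<pi> i \<in> pa G (\<pi> j) \<longrightarrow> i < j)"

definition graph_of_matrix :: "real^'n^'n \<Rightarrow> ('n \<times> 'n) set" where
  "graph_of_matrix K = {(j, i). j \<noteq> i \<and> K $ j $ i = 1}"

section \<open>Conditional densities and factorization\<close>

definition upd :: "real^'n \<Rightarrow> 'n \<Rightarrow> real \<Rightarrow> real^'n" where
  "upd z i t = (\<chi> k. if k = i then t else z $ k)"

definition depends_only_on :: "'n set \<Rightarrow> (real^'n \<Rightarrow> real) \<Rightarrow> bool" where
  "depends_only_on S f \<longleftrightarrow> (\<forall>z z'. (\<forall>k\<in>S. z $ k = z' $ k) \<longrightarrow> f z = f z')"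

text \<open>A conditional density of node \<open>i\<close> given its parents, \<open>f(z_i | z_pa(i))\<close>, is written as a
  function of the whole vector \<open>z\<close> that only depends on the coordinates \<open>i\<close> and \<open>pa(i)\<close>.\<close>
definition cond_density :: "('n \<times> 'n) set \<Rightarrow> 'n \<Rightarrow> (real^'n \<Rightarrow> real) \<Rightarrow> bool" where
  "cond_density G i f \<longleftrightarrow>
     depends_only_on (insert i (pa G i)) f \<and>
     f \<in> borel_measurable borel \<and>
     (\<forall>z. 0 \<le> f z) \<and>
     (\<forall>z. (\<integral>\<^sup>+ t. ennreal (f (upd z i t)) \<partial>lborel) = 1)"

definition factorizes :: "('n \<times> 'n) set \<Rightarrow> 'w measure \<Rightarrow> ('w \<Rightarrow> real^'n) \<Rightarrow> bool" where
  "factorizes G M Y \<longleftrightarrow>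
     (\<exists>f. (\<forall>i. cond_density G i (f i)) \<and>
          distributed M lborel Y (\<lambda>z. ennreal (\<Prod>i\<in>UNIV. f i z)))"

definition C1_function :: "('a::real_inner \<Rightarrow> real) \<Rightarrow> bool" where
  "C1_function f \<longleftrightarrow> (\<exists>g. (\<forall>z. GDERIV f z :> g z) \<and> continuous_on UNIV g)"

definition partial_deriv :: "'n \<Rightarrow> (real^'n \<Rightarrow> real) \<Rightarrow> real^'n \<Rightarrow> real" where
  "partial_deriv k f z = deriv (\<lambda>t. f (upd z k t)) (z $ k)"

section \<open>Environments\<close>

datatype 'n environment = Obs | Interv 'n

text \<open>\<open>m i\<close> is the environment in which node \<open>i\<close> is intervened.\<close>
fun latent_density ::
  "('n \<Rightarrow> real^'n \<Rightarrow> real) \<Rightarrow> ('n \<Rightarrow> real^'n \<Rightarrow> real) \<Rightarrow> ('n \<Rightarrow> 'n) \<Rightarrow>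
   'n environment \<Rightarrow> real^'n \<Rightarrow> real" where
  "latent_density p q m Obs z = (\<Prod>j\<in>UNIV. p j z)"
| "latent_density p q m (Interv e) z =
     (let i = inv m e in q i z * (\<Prod>j\<in>UNIV - {i}. p j z))"

section \<open>Scores\<close>

text \<open>Gradient along a linear subspace \<open>W\<close>, at a point \<open>x\<close> of \<open>W\<close>: the vector of \<open>W\<close> representing the
  derivative of the restriction of \<open>f\<close> to \<open>W\<close>. For \<open>W = UNIV\<close> it is the ordinary gradient.\<close>
definition gradient_along :: "'a::real_inner set \<Rightarrow> ('a \<Rightarrow> real) \<Rightarrow> 'a \<Rightarrow> 'a" where
  "gradient_along W f x =
     (THE g. g \<in> W \<and> (f has_derivative (\<lambda>h. h \<bullet> g)) (at x within W))"

definition score_along :: "'a::real_inner set \<Rightarrow> ('a \<Rightarrow> real) \<Rightarrow> 'a \<Rightarrow> 'a" where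
  "score_along W f = gradient_along W (\<lambda>x. ln (f x))"

text \<open>\<open>n\<close>-dimensional Lebesgue measure on the column space of a full-column-rank matrix \<open>T\<close>: the image
  of Lebesgue measure on \<open>\<real>\<^sup>n\<close> under a linear isometry onto \<open>im T\<close>, given by a matrix whose columns
  are an orthonormal basis of \<open>im T\<close>. Two such matrices differ by an orthogonal \<open>n \<times> n\<close> factor, so
  the measure does not depend on the choice.\<close>
definition lebesgue_im :: "real^'n^'d \<Rightarrow> (real^'d) measure" where
  "lebesgue_im T =
     (let Q = (SOME Q::real^'n^'d. transpose Q ** Q = mat 1 \<and> im Q = im T)
      in distr lborel borel (\<lambda>y. Q *v y))"

section \<open>Candidate transformations\<close>

definition candidates :: "real^'n^'d \<Rightarrow> (real^'n^'d) set" where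
  "candidates T =
     {U. rank U = CARD('n) \<and> (\<forall>x\<in>im T. (U ** pinv U) *v x = x)}"

text \<open>Here \<open>M\<close>, \<open>X\<close> are the observational probability space and observed vector, and \<open>s e\<close> is the
  score function of the observed vector in environment \<open>e\<close>.\<close>
definition score_change ::
  "'w measure \<Rightarrow> ('w \<Rightarrow> real^'d) \<Rightarrow> ('n environment \<Rightarrow> real^'d \<Rightarrow> real^'d) \<Rightarrow>
   real^'d^'n \<Rightarrow> real^'n^'n" where
  "score_change M X s A =
     (\<chi> i m. if (AE \<omega> in M. (A *v s Obs (X \<omega>)) $ i = (A *v s (Interv m) (X \<omega>)) $ i)
              then 0 else 1)"

definition candidates1 ::
  "real^'n^'d \<Rightarrow> (real^'d^'n \<Rightarrow> real^'n^'n) \<Rightarrow> (real^'n^'d) set" where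
  "candidates1 T \<Delta> =
     {V. is_arg_min (\<lambda>U. norm0 (\<Delta> (transpose U))) (\<lambda>U. U \<in> candidates T) V}"

definition candidatesS ::
  "real^'n::{finite,wellorder}^'d \<Rightarrow>
   (real^'d^'n::{finite,wellorder} \<Rightarrow> real^'n::{finite,wellorder}^'n::{finite,wellorder}) \<Rightarrow>
   (real^'n::{finite,wellorder}^'d) set" where
  "candidatesS T \<Delta> =
     {U \<in> candidates1 T \<Delta>. \<exists>P\<in>perm_matrices. upper_triangular (\<Delta> (transpose U) ** P)}"

end

theory Submission
  imports Defs
begin

text \<open>
  Every candidate is \<open>U = T H\<close> with \<open>H\<close> invertible, and \<open>U\<^sup>T s\<^sub>X = H\<^sup>T s\<^sub>Z\<close>. The change of the score
  under an intervention on \<open>i\<close> only involves the coordinates \<open>pa(i) \<union> {i}\<close>, and by (A3) a linear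
  functional kills it almost surely only if it vanishes on these coordinates. So row \<open>r\<close> of the score
  change matrix is nonzero exactly at the nodes in the union of the closed child sets of the support
  of column \<open>r\<close> of \<open>H\<close>. Since \<open>det H \<noteq> 0\<close>, some bijection \<open>\<sigma>\<close> satisfies \<open>H (\<sigma> r) r \<noteq> 0\<close>, so the number of
  nonzero entries is at least the total size of the closed child sets, which \<open>H = I\<close> attains; at the
  minimum the support of column \<open>r\<close> therefore lies in \<open>{\<sigma> r}\<close> together with the nodes surrounded by
  \<open>\<sigma> r\<close>. Upper triangularity forces the column permutation to be \<open>\<sigma>\<close> as well, which gives the graph
  and the causal order. Surrounding is transitive, so the sparsity pattern of \<open>H\<close> passes to its inverse.
\<close>

section \<open>Linear changes of variables\<close>

text \<open>Pairing the Gram matrix applied to \<open>z\<close> with \<open>z\<close> gives the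
  squared length of \<open>U *v z\<close>, so its kernel is trivial and \<open>matrix_inv\<close>
  picks a true inverse.\<close>

lemma pinv_left_inverse:
  fixes U :: "real^'n^'d"
  assumes "rank U = CARD('n)"
  shows "pinv U ** U = mat 1"
proof -
  have inj: "inj ((*v) U)"
    using assms by (simp add: full_rank_injective)
  have ker: "z = 0" if "(transpose U ** U) *v z = 0" for z
  proof -
    have "(U *v z) \<bullet> (U *v z) = z \<bullet> (transpose U *v (U *v z))"
      by (simp add: dot_lmul_matrix[symmetric] inner_commute)
    also have "\<dots> = 0"
      using that by (simp add: matrix_vector_mul_assoc)
    finally have "U *v z = U *v 0"
      by simp
    then show "z = 0"
      using inj by (simp only: inj_eq)
  qed
  then have "\<exists>B. B ** (transpose U ** U) = mat 1"
    by (simp only: matrix_left_invertible_ker) blast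
  then have "invertible (transpose U ** U)"
    by (simp add: invertible_left_inverse)
  then have "matrix_inv (transpose U ** U) ** (transpose U ** U) = mat 1"
    unfolding invertible_def matrix_inv_def by (rule someI2_ex) simp
  then show ?thesis
    by (simp add: pinv_def matrix_mul_assoc)
qed

lemma measurable_matrix_vector_mult [measurable]:
  fixes A :: "real^'n^'d"
  shows "(*v) A \<in> borel_measurable borel"
  by (intro borel_measurable_continuous_onI continuous_intros)

text \<open>Lebesgue measure is determined by its values on boxes. The preimage of a box under
  \<open>A\<close> is its image under \<open>B\<close>, so its volume is scaled by the absolute
  determinant of \<open>B\<close>.\<close>

lemma distr_lborel_matrix:
  fixes A B :: "real^'n::{finite,wellorder}^'n::{finite,wellorder}"
  assumes AB: "A ** B = mat 1"
  shows "distr lborel lborel ((*v) A) = density lborel (\<lambda>_. ennreal \<bar>det B\<bar>)"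
proof -
  have BA: "B ** A = mat 1"
    using AB by (simp add: matrix_left_right_inverse)
  have det: "\<bar>det A\<bar> * \<bar>det B\<bar> = 1"
    using arg_cong[OF AB, of det] by (simp add: det_mul flip: abs_mult)
  have vimage: "(*v) A -` S = (*v) B ` S" for S
  proof (intro equalityI subsetI)
    fix x assume "x \<in> (*v) A -` S"
    then have "B *v (A *v x) \<in> (*v) B ` S"
      by auto
    then show "x \<in> (*v) B ` S"
      by (simp add: matrix_vector_mul_assoc BA)
  next
    fix x assume "x \<in> (*v) B ` S"
    then show "x \<in> (*v) A -` S"
      by (auto simp: matrix_vector_mul_assoc AB)
  qed
  have "lborel = density (distr lborel borel ((*v) A)) (\<lambda>_. ennreal \<bar>det A\<bar>)" (is "_ = ?D")
  proof (rule lborel_eqI)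
    fix l u :: "real^'n::{finite,wellorder}"
    assume lu: "\<And>b. b \<in> Basis \<Longrightarrow> l \<bullet> b \<le> u \<bullet> b"
    have meas [measurable]: "(*v) A -` box l u \<in> sets borel"
      using measurable_sets[OF measurable_matrix_vector_mult[of A], of "box l u"] by simp
    have lm: "(*v) B ` box l u \<in> lmeasurable"
      by (intro measurable_linear_image) auto
    have "emeasure lborel ((*v) A -` box l u) = emeasure lebesgue ((*v) B ` box l u)"
      using meas by (simp add: vimage)
    also have "\<dots> = ennreal (measure lebesgue ((*v) B ` box l u))"
      using lm by (simp add: emeasure_eq_measure2 fmeasurableD2)
    also have "\<dots> = ennreal (\<bar>det B\<bar> * measure lebesgue (box l u))"
      by (subst measure_linear_image) auto
    finally have em: "emeasure lborel ((*v) A -` box l u) = ennreal (\<bar>det B\<bar> * measure lebesgue (box l u))" .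
    have "emeasure ?D (box l u) = ennreal \<bar>det A\<bar> * emeasure lborel ((*v) A -` box l u)"
      by (simp add: emeasure_density nn_integral_cmult emeasure_distr)
    also have "\<dots> = ennreal (measure lebesgue (box l u))"
      using det by (simp add: em ennreal_mult'[symmetric] mult.assoc[symmetric])
    also have "\<dots> = (\<Prod>b\<in>Basis. (u - l) \<bullet> b)"
      using lu by (simp add: measure_lborel_box_eq inner_diff_left)
    finally show "emeasure ?D (box l u) = (\<Prod>b\<in>Basis. (u - l) \<bullet> b)" .
  qed simp
  then have "density lborel (\<lambda>_. ennreal \<bar>det B\<bar>) = density ?D (\<lambda>_. ennreal \<bar>det B\<bar>)"
    by simp
  also have "\<dots> = density (distr lborel borel ((*v) A)) (\<lambda>_. ennreal (\<bar>det A\<bar> * \<bar>det B\<bar>))"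
    by (simp add: density_density_eq ennreal_mult')
  also have "\<dots> = distr lborel borel ((*v) A)"
    by (simp add: det density_1)
  also have "\<dots> = distr lborel lborel ((*v) A)"
    by (intro distr_cong) auto
  finally show ?thesis ..
qed

lemma distributed_matrix:
  fixes A B :: "real^'n::{finite,wellorder}^'n::{finite,wellorder}"
  assumes AB: "A ** B = mat 1" and D: "distributed M lborel Z f"
  shows "distributed M lborel (\<lambda>\<omega>. A *v Z \<omega>) (\<lambda>y. ennreal \<bar>det B\<bar> * f (B *v y))"
proof -
  have BA: "B ** A = mat 1"
    using AB by (simp add: matrix_left_right_inverse)
  have [measurable]: "f \<in> borel_measurable lborel" "Z \<in> measurable M lborel"
    and dZ: "distr M lborel Z = density lborel f"
    using D by (auto simp: distributed_def)
  have [measurable]: "(\<lambda>y. f (B *v y)) \<in> borel_measurable lborel"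
    by measurable
  have [measurable]: "(*v) A \<in> measurable lborel lborel"
    by simp
  have "distr M lborel (\<lambda>\<omega>. A *v Z \<omega>) = distr (distr M lborel Z) lborel ((*v) A)"
    using \<open>Z \<in> measurable M lborel\<close> by (subst distr_distr) (auto simp: comp_def)
  \<comment> \<open>Written as a function of \<open>A *v z\<close>, the density can be pulled out of
    the push-forward.\<close>
  also have "\<dots> = distr (density lborel (\<lambda>z. f (B *v (A *v z)))) lborel ((*v) A)"
    by (simp add: dZ matrix_vector_mul_assoc BA)
  also have "\<dots> = density (distr lborel lborel ((*v) A)) (\<lambda>y. f (B *v y))"
    by (rule density_distr[symmetric]) auto
  also have "\<dots> = density lborel (\<lambda>y. ennreal \<bar>det B\<bar> * f (B *v y))"
    by (simp add: distr_lborel_matrix[OF AB] density_density_eq)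
  finally show ?thesis
    using measurable_comp[OF \<open>Z \<in> measurable M lborel\<close>, of "(*v) A" lborel]
    by (simp add: distributed_def comp_def)
qed

text \<open>Ensures that the choice in \<open>lebesgue_im\<close> picks an actual isometry: the
  columns of \<open>Q\<close> enumerate an orthonormal basis of the image.\<close>

lemma orthonormal_matrix_exists:
  fixes T :: "real^'n^'d"
  assumes "rank T = CARD('n)"
  shows "\<exists>Q::real^'n^'d. transpose Q ** Q = mat 1 \<and> im Q = im T"
proof -
  have sub: "subspace (im T)"
    by (intro linear_subspace_image) auto
  obtain C where C: "C \<subseteq> im T" "pairwise orthogonal C" "\<And>x. x \<in> C \<Longrightarrow> norm x = 1"
    "independent C" "card C = dim (im T)" "span C = im T"
    using orthonormal_basis_subspace[OF sub] by metis
  have "card C = CARD('n)"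
    using assms C(5) by (simp add: rank_dim_range)
  moreover have "finite C"
    using C(4) by (rule independent_imp_finite)
  ultimately obtain f where f: "bij_betw f (UNIV :: 'n set) C"
    by (metis finite_same_card_bij finite)
  define Q :: "real^'n^'d" where "Q = (\<chi> i j. f j $ i)"
  have Qax: "Q *v x = (\<Sum>j\<in>UNIV. (x $ j) *\<^sub>R f j)" for x
    by (simp add: Q_def vec_eq_iff matrix_vector_mult_def mult.commute)
  have "f i \<bullet> f j = (if i = j then 1 else 0)" for i j
  proof (cases "i = j")
    case True
    then show ?thesis
      using C(3) f by (auto simp: bij_betw_def norm_eq_1)
  next
    case False
    then have "f i \<noteq> f j" "f i \<in> C" "f j \<in> C"
      using f by (auto simp: bij_betw_def inj_eq)
    then show ?thesis
      using C(2) False by (auto simp: pairwise_def orthogonal_def)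
  qed
  then have "transpose Q ** Q = mat 1"
    by (simp add: vec_eq_iff matrix_matrix_mult_def transpose_def Q_def mat_def inner_vec_def)
  moreover have "im Q = im T"
  proof
    show "im Q \<subseteq> im T"
      using C(1) f sub by (auto simp: Qax bij_betw_def intro!: subspace_sum subspace_scale)
    have "f j = Q *v axis j 1" for j
      by (simp add: Qax axis_def if_distrib[of "\<lambda>x. x *\<^sub>R _"] cong: if_cong)
    then have "C \<subseteq> im Q"
      using f by (auto simp: bij_betw_def)
    moreover have "subspace (im Q)"
      by (intro linear_subspace_image) auto
    ultimately show "im T \<subseteq> im Q"
      using C(6) span_minimal by blast
  qed
  ultimately show ?thesis
    by blast
qed

text \<open>The set where the functions differ is open and null, hence empty.\<close>

lemma continuous_eq_if_AE_lborel:
  fixes f g :: "'a::euclidean_space \<Rightarrow> real"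
  assumes "continuous_on UNIV f" "continuous_on UNIV g" and ae: "AE x in lborel. f x = g x"
  shows "f x = g x"
proof -
  have op: "open {x. f x \<noteq> g x}"
    using assms(1,2) by (intro open_Collect_neq)
  then have "{x. f x \<noteq> g x} \<in> null_sets lborel"
    using ae by (subst (asm) AE_iff_null) auto
  then have "negligible {x. f x \<noteq> g x}"
    by (simp add: negligible_iff_null_sets null_sets_completionI)
  then show ?thesis
    using op open_not_negligible by blast
qed

text \<open>A density is determined only almost everywhere; continuity upgrades the
  change-of-variables formula to every point, as pointwise scores require.\<close>

lemma density_on_image:
  fixes T :: "real^'n::{finite,wellorder}^'d"
  assumes prob: "prob_space M" and rank_T: "rank T = CARD('n)"
    and law_Z: "distributed M lborel Z (\<lambda>z. ennreal (pZ z))"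
    and pos: "\<And>z. 0 < pZ z" and cont_pZ: "continuous_on UNIV pZ"
    and X: "\<And>\<omega>. \<omega> \<in> space M \<Longrightarrow> X \<omega> = T *v Z \<omega>"
    and law_X: "distributed M (lebesgue_im T) X (\<lambda>x. ennreal (pX x))"
    and cont_pX: "continuous_on (im T) pX"
  shows "\<exists>c>0. \<forall>z. pX (T *v z) = c * pZ z"
proof -
  define Q :: "real^'n::{finite,wellorder}^'d" where "Q = (SOME Q. transpose Q ** Q = mat 1 \<and> im Q = im T)"
  have Q: "transpose Q ** Q = mat 1" "im Q = im T"
    using someI_ex[OF orthonormal_matrix_exists[OF rank_T]] by (auto simp: Q_def)
  have Qt: "transpose Q *v (Q *v y) = y" for y
    by (simp only: matrix_vector_mul_assoc Q matrix_vector_mul_lid)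
  have L: "lebesgue_im T = distr lborel borel ((*v) Q)"
    by (simp add: lebesgue_im_def Q_def)
  \<comment> \<open>\<open>R\<close> is \<open>T\<close> in the coordinates of the orthonormal basis
    \<open>Q\<close>, so that \<open>T = Q ** R\<close>; \<open>R'\<close> is the inverse of
    \<open>R\<close>.\<close>
  define R where "R = transpose Q ** T"
  define R' where "R' = pinv T ** Q"
  have QR: "Q *v (R *v z) = T *v z" for z
  proof -
    have "T *v z \<in> im Q"
      using Q by auto
    then obtain y where y: "T *v z = Q *v y"
      by auto
    have "R *v z = transpose Q *v (T *v z)"
      by (simp only: R_def matrix_vector_mul_assoc)
    also have "\<dots> = y"
      by (simp only: y Qt)
    finally show ?thesis
      using y by simp
  qed
  have "R' *v (R *v z) = pinv T *v (T *v z)" for z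
    by (simp only: R'_def QR flip: matrix_vector_mul_assoc)
  then have "R' *v (R *v z) = z" for z
    by (simp only: matrix_vector_mul_assoc pinv_left_inverse[OF rank_T] matrix_vector_mul_lid)
  then have R'R: "R' ** R = mat 1"
    by (simp add: matrix_eq flip: matrix_vector_mul_assoc)
  then have RR': "R ** R' = mat 1"
    by (simp add: matrix_left_right_inverse)
  have pX_meas: "(\<lambda>x. ennreal (pX x)) \<in> borel_measurable borel"
    and X_meas: "X \<in> measurable M borel"
    and dX: "distr M (lebesgue_im T) X = density (lebesgue_im T) (\<lambda>x. ennreal (pX x))"
    using law_X by (auto simp: distributed_def L)
  note [measurable] = pX_meas X_meas
  have [measurable]: "(*v) (transpose Q) \<in> measurable borel borel"
    by simp
  interpret prob_space M by fact
  \<comment> \<open>The same random vector is read as \<open>R\<close> applied to the latent vector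
    and as the \<open>Q\<close>-coordinates of \<open>X\<close>; its two densities are then
    compared.\<close>
  have "distr M lborel (\<lambda>\<omega>. R *v Z \<omega>) = distr M lborel (\<lambda>\<omega>. transpose Q *v X \<omega>)"
    by (intro distr_cong) (auto simp: X R_def matrix_vector_mul_assoc simp del: transpose_matrix_vector)
  also have "\<dots> = distr (distr M (lebesgue_im T) X) lborel ((*v) (transpose Q))"
    by (subst distr_distr) (auto simp: L comp_def)
  also have "\<dots> = distr (distr (density lborel (\<lambda>y. ennreal (pX (Q *v y)))) borel ((*v) Q)) lborel ((*v) (transpose Q))"
    unfolding dX unfolding L by (subst density_distr) auto
  also have "\<dots> = distr (density lborel (\<lambda>y. ennreal (pX (Q *v y)))) lborel (\<lambda>y. y)"
    by (subst distr_distr) (auto simp: comp_def Qt simp del: transpose_matrix_vector)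
  also have "\<dots> = density lborel (\<lambda>y. ennreal (pX (Q *v y)))"
    by (rule distr_id2) simp
  finally have "distributed M lborel (\<lambda>\<omega>. R *v Z \<omega>) (\<lambda>y. ennreal (pX (Q *v y)))"
    using distributed_matrix[OF RR' law_Z] by (simp add: distributed_def)
  from distributed_unique[OF this distributed_matrix[OF RR' law_Z]]
  have "AE y in lborel. ennreal (pX (Q *v y)) = ennreal \<bar>det R'\<bar> * ennreal (pZ (R' *v y))" .
  moreover have c: "0 < \<bar>det R'\<bar>"
    using arg_cong[OF R'R, of det] by (auto simp: det_mul)
  ultimately have ae: "AE y in lborel. pX (Q *v y) = \<bar>det R'\<bar> * pZ (R' *v y)"
  proof (elim AE_mp, intro AE_I2 impI)
    fix y assume eq: "ennreal (pX (Q *v y)) = ennreal \<bar>det R'\<bar> * ennreal (pZ (R' *v y))"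
    \<comment> \<open>\<open>ennreal\<close> sends negative reals to 0, so positivity of the
      right-hand side rules out a negative value of \<open>pX\<close>.\<close>
    have "0 < \<bar>det R'\<bar> * pZ (R' *v y)"
      using c pos by simp
    then show "pX (Q *v y) = \<bar>det R'\<bar> * pZ (R' *v y)"
      using eq by (cases "0 \<le> pX (Q *v y)") (auto simp: ennreal_neg simp flip: ennreal_mult')
  qed
  have c1: "continuous_on UNIV (\<lambda>y. pX (Q *v y))"
    using Q by (intro continuous_on_compose2[OF cont_pX] continuous_intros) auto
  have c2: "continuous_on UNIV (\<lambda>y. \<bar>det R'\<bar> * pZ (R' *v y))"
    by (intro continuous_intros continuous_on_compose2[OF cont_pZ]) auto
  have all: "pX (Q *v y) = \<bar>det R'\<bar> * pZ (R' *v y)" for y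
    by (rule continuous_eq_if_AE_lborel[OF c1 c2 ae])
  have "pX (T *v z) = \<bar>det R'\<bar> * pZ z" for z
    by (simp only: all[of "R *v z", unfolded QR] matrix_vector_mul_assoc R'R matrix_vector_mul_lid)
  then show ?thesis
    using c by blast
qed

section \<open>Scores\<close>

lemma inner_transpose: "x \<bullet> (transpose A *v y) = (A *v x) \<bullet> y"
  for A :: "real^'n^'d"
  by (metis dot_lmul_matrix inner_commute transpose_matrix_vector)

text \<open>Two representing vectors in \<open>W\<close> differ by a direction \<open>h\<close> of
  \<open>W\<close>; differentiating along the line through \<open>x\<close> in direction
  \<open>h\<close> gives \<open>h \<bullet> h = 0\<close>.\<close>

lemma gradient_along_eqI:
  assumes W: "subspace W" "x \<in> W" and g: "g \<in> W"
    and D: "(f has_derivative (\<lambda>h. h \<bullet> g)) (at x within W)"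
  shows "gradient_along W f x = g"
  unfolding gradient_along_def
proof (rule the_equality)
  show "g \<in> W \<and> (f has_derivative (\<lambda>h. h \<bullet> g)) (at x within W)"
    using g D by blast
  fix g'
  assume g': "g' \<in> W \<and> (f has_derivative (\<lambda>h. h \<bullet> g')) (at x within W)"
  define h where "h = g' - g"
  have h: "h \<in> W"
    using g g' W by (simp add: h_def subspace_diff)
  have line: "((\<lambda>t. f (x + t *\<^sub>R h)) has_derivative (\<lambda>t. (t *\<^sub>R h) \<bullet> v)) (at 0)"
    if "(f has_derivative (\<lambda>h. h \<bullet> v)) (at x within W)" for v
  proof (rule has_derivative_in_compose[of "\<lambda>t. x + t *\<^sub>R h"])
    show "((\<lambda>t. x + t *\<^sub>R h) has_derivative (\<lambda>t. t *\<^sub>R h)) (at 0)"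
      by (auto intro!: derivative_eq_intros)
    show "(f has_derivative (\<lambda>h. h \<bullet> v)) (at (x + 0 *\<^sub>R h) within range (\<lambda>t. x + t *\<^sub>R h))"
      using that W h by (auto intro: has_derivative_subset subspace_add subspace_scale)
  qed
  have "h \<bullet> g = h \<bullet> g'"
    using has_derivative_unique[OF line[OF D] line[OF g'[THEN conjunct2]], THEN fun_cong, of 1]
    by simp
  then have "h \<bullet> h = 0"
    by (simp add: h_def inner_diff_right)
  then show "g' = g"
    by (simp add: h_def)
qed

lemma C1_function_continuous_on:
  assumes "C1_function f"
  shows "continuous_on S f"
proof -
  obtain g where "\<And>z. (f has_derivative (\<lambda>h. h \<bullet> g z)) (at z)"
    using assms by (auto simp: C1_function_def gderiv_def)
  then show ?thesis
    by (meson continuous_at_imp_continuous_on has_derivative_continuous)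
qed

text \<open>Shows that the definite description behind the score denotes: the gradient divided by
  \<open>f z\<close> satisfies it.\<close>

lemma ln_has_derivative_score:
  fixes f :: "real^'n \<Rightarrow> real"
  assumes "C1_function f" "\<And>z. 0 < f z"
  shows "((\<lambda>z. ln (f z)) has_derivative (\<lambda>h. h \<bullet> score_along UNIV f z)) (at z)"
proof -
  obtain g where g: "(f has_derivative (\<lambda>h. h \<bullet> g)) (at z)"
    using assms(1) by (auto simp: C1_function_def gderiv_def)
  have "((\<lambda>z. ln (f z)) has_derivative (\<lambda>h. h \<bullet> (g /\<^sub>R f z))) (at z)"
    using assms(2)[of z] by (auto intro!: derivative_eq_intros g simp: field_simps)
  moreover from this have "score_along UNIV f z = g /\<^sub>R f z"
    unfolding score_along_def by (intro gradient_along_eqI) auto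
  ultimately show ?thesis
    by simp
qed

lemma ln_prod_has_derivative_score:
  fixes f :: "'i::finite \<Rightarrow> real^'n \<Rightarrow> real"
  assumes "\<And>j. C1_function (f j)" "\<And>j z. 0 < f j z"
  shows "((\<lambda>z. ln (\<Prod>j\<in>UNIV. f j z)) has_derivative
    (\<lambda>h. h \<bullet> (\<Sum>j\<in>UNIV. score_along UNIV (f j) z))) (at z)"
  using assms
  by (simp add: ln_prod inner_sum_right less_imp_neq[symmetric])
    (intro has_derivative_sum ln_has_derivative_score)

text \<open>The logarithm makes the score additive over factors, so an intervention alters a single
  summand.\<close>

lemma score_along_prod:
  fixes f :: "'i::finite \<Rightarrow> real^'n \<Rightarrow> real"
  assumes "\<And>j. C1_function (f j)" "\<And>j z. 0 < f j z"
  shows "score_along UNIV (\<lambda>z. \<Prod>j\<in>UNIV. f j z) z = (\<Sum>j\<in>UNIV. score_along UNIV (f j) z)"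
  unfolding score_along_def[of _ "\<lambda>z. \<Prod>j\<in>UNIV. f j z"]
  using ln_prod_has_derivative_score[OF assms] by (intro gradient_along_eqI) auto

text \<open>Moving in direction \<open>c\<close> leaves the coordinates in \<open>S\<close> fixed,
  so \<open>f\<close> is constant on that line.\<close>

lemma score_along_depends_only_on:
  fixes f :: "real^'n \<Rightarrow> real"
  assumes f: "C1_function f" "\<And>z. 0 < f z" and S: "depends_only_on S f"
    and c: "\<And>k. k \<in> S \<Longrightarrow> c $ k = 0"
  shows "c \<bullet> score_along UNIV f z = 0"
proof -
  have "((\<lambda>t. ln (f (z + t *\<^sub>R c))) has_derivative (\<lambda>t. (t *\<^sub>R c) \<bullet> score_along UNIV f z)) (at 0)"
    using ln_has_derivative_score[OF f, of z]
    by (intro has_derivative_compose[of "\<lambda>t. z + t *\<^sub>R c" _ 0 UNIV "\<lambda>z. ln (f z)"])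
      (auto intro!: derivative_eq_intros)
  moreover have "f (z + t *\<^sub>R c) = f z" for t
    using S c by (simp add: depends_only_on_def)
  ultimately have "((\<lambda>t. ln (f z)) has_derivative (\<lambda>t. (t *\<^sub>R c) \<bullet> score_along UNIV f z)) (at (0::real))"
    by simp
  from has_derivative_unique[OF this has_derivative_const, THEN fun_cong, of 1]
  show ?thesis
    by simp
qed

text \<open>On \<open>im T\<close> the log-density is a constant plus \<open>ln f\<close> composed
  with \<open>pinv T\<close>. By the chain rule its gradient is the transpose of
  \<open>pinv T\<close> applied to \<open>s\<close>, which \<open>transpose T\<close>
  undoes.\<close>

lemma score_along_image:
  fixes T :: "real^'n^'d"
  assumes rank_T: "rank T = CARD('n)" and c: "0 < c"
    and pX: "\<And>z. pX (T *v z) = c * f z" and f: "\<And>z. 0 < f z"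
    and D: "((\<lambda>z. ln (f z)) has_derivative (\<lambda>h. h \<bullet> s)) (at z)"
  shows "transpose T *v score_along (im T) pX (T *v z) = s"
proof -
  have inv: "pinv T *v (T *v z) = z" for z
    by (simp only: matrix_vector_mul_assoc pinv_left_inverse[OF rank_T] matrix_vector_mul_lid)
  define g where "g = transpose (pinv T) *v s"
  have g: "h \<bullet> g = (pinv T *v h) \<bullet> s" for h
    by (simp only: g_def inner_transpose)
  have sub: "subspace (im T)"
    by (intro linear_subspace_image) auto
  have deriv: "((\<lambda>x. ln c + ln (f (pinv T *v x))) has_derivative (\<lambda>h. h \<bullet> g)) (at (T *v z) within im T)"
  proof -
    have "((\<lambda>x. ln (f (pinv T *v x))) has_derivative (\<lambda>h. (pinv T *v h) \<bullet> s)) (at (T *v z) within im T)"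
      using D by (intro has_derivative_compose[of "\<lambda>x. pinv T *v x" _ _ _ "\<lambda>z. ln (f z)"])
        (auto simp: inv intro!: bounded_linear_imp_has_derivative)
    from has_derivative_add[OF has_derivative_const this] show ?thesis
      by (simp add: g)
  qed
  have "((\<lambda>x. ln (pX x)) has_derivative (\<lambda>h. h \<bullet> g)) (at (T *v z) within im T)"
    by (rule has_derivative_transform[OF _ _ deriv]) (auto simp: pX inv ln_mult_pos[OF c f])
  \<comment> \<open>The transpose of \<open>pinv T\<close> has \<open>T\<close> as its leftmost
    factor.\<close>
  moreover have "g \<in> im T"
    by (auto simp: g_def pinv_def matrix_transpose_mul simp flip: matrix_vector_mul_assoc
        simp del: transpose_matrix_vector)
  ultimately have "score_along (im T) pX (T *v z) = g"
    unfolding score_along_def using sub by (intro gradient_along_eqI) auto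
  moreover have "transpose T *v g = s"
  proof (rule vector_eq_ldot[THEN iffD1, rule_format])
    fix h
    have "h \<bullet> (transpose T *v g) = (T *v h) \<bullet> g"
      by (rule inner_transpose)
    then show "h \<bullet> (transpose T *v g) = h \<bullet> s"
      by (simp add: g inv)
  qed
  ultimately show ?thesis
    by simp
qed

section \<open>Sparsity patterns\<close>

lemma acyclic_childD:
  assumes "acyclic G" "j \<in> ch G i"
  shows "i \<noteq> j" "i \<notin> ch G j"
  using assms by (auto simp: ch_def acyclic_def) (meson r_into_trancl trancl_into_trancl)+

text \<open>The inclusion makes \<open>k\<close> a child of \<open>l\<close>; hence \<open>l\<close>
  is no child of \<open>k\<close>, and dropping \<open>l\<close> from the right-hand side loses
  nothing.\<close>

lemma surI:
  assumes G: "acyclic G" and sub: "insert k (ch G k) \<subseteq> insert l (ch G l)" and "k \<noteq> l"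
  shows "l \<in> sur G k"
  using assms acyclic_childD[OF G, of k l] by (auto simp: sur_def)

text \<open>The inclusions compose, making \<open>k\<close> a child of \<open>j\<close>, and
  acyclicity then separates \<open>j\<close> from \<open>k\<close>.\<close>

lemma sur_trans: "l \<in> sur G k \<Longrightarrow> j \<in> sur G l \<Longrightarrow> acyclic G \<Longrightarrow> j \<in> sur G k"
  using acyclic_childD[of G k j] by (auto simp: sur_def)

text \<open>Column \<open>r\<close> belongs to node \<open>\<sigma> r\<close>, with a nonzero pivot
  there; the parameter \<open>\<sigma>\<close> lets the same notion cover matrices before and after
  reordering the columns.\<close>

definition sur_pattern :: "('n \<times> 'n) set \<Rightarrow> ('n \<Rightarrow> 'n) \<Rightarrow> real^'n^'n \<Rightarrow> bool" where
  "sur_pattern G \<sigma> H \<longleftrightarrow> (\<forall>r. H $ \<sigma> r $ r \<noteq> 0) \<and>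
    (\<forall>k r. H $ k $ r \<noteq> 0 \<longrightarrow> k = \<sigma> r \<or> \<sigma> r \<in> sur G k)"

text \<open>A surrounding node is in particular a parent, so surrounding patterns are
  triangular.\<close>

lemma sur_less:
  assumes "\<And>i j. i \<in> pa G j \<Longrightarrow> i < j" and "l \<in> sur G k"
  shows "l < k"
  using assms by (auto simp: sur_def ch_def pa_def)

lemma minimal_pattern:
  fixes H :: "real^'n^'n" and G :: "('n \<times> 'n) set"
  assumes G: "acyclic G" and H: "det H \<noteq> 0"
    and D: "\<And>r i. i \<in> D r \<longleftrightarrow> (\<exists>k\<in>insert i (pa G i). H $ k $ r \<noteq> 0)"
    and min: "(\<Sum>r\<in>UNIV. card (D r)) \<le> (\<Sum>k\<in>UNIV. card (insert k (ch G k)))"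
  obtains \<sigma> where "bij \<sigma>" "sur_pattern G \<sigma> H" "\<And>r. D r = insert (\<sigma> r) (ch G (\<sigma> r))"
proof -
  \<comment> \<open>Some term of the Leibniz expansion of the determinant is nonzero.\<close>
  have "\<exists>p. p permutes UNIV \<and> (\<forall>i. H $ i $ p i \<noteq> 0)"
  proof (rule ccontr)
    assume "\<not> ?thesis"
    then have "det H = 0"
      unfolding det_def by (intro sum.neutral) (auto intro!: prod_zero)
    with H show False ..
  qed
  then obtain p where p: "bij p" "\<And>i. H $ i $ p i \<noteq> 0"
    using permutes_bij by blast
  define \<sigma> where "\<sigma> = inv p"
  have \<sigma>: "bij \<sigma>"
    using p by (simp add: \<sigma>_def bij_imp_bij_inv)
  have nz: "H $ \<sigma> r $ r \<noteq> 0" for r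
    using p(2)[of "\<sigma> r"] p(1) by (simp add: \<sigma>_def bij_is_surj surj_f_inv_f)
  have D_sup: "insert k (ch G k) \<subseteq> D r" if "H $ k $ r \<noteq> 0" for k r
    using that by (auto simp: D pa_def ch_def)
  have "(\<Sum>r\<in>UNIV. card (insert (\<sigma> r) (ch G (\<sigma> r)))) = (\<Sum>k\<in>UNIV. card (insert k (ch G k)))"
    using \<sigma> by (rule sum.reindex_bij_betw)
  moreover have le: "card (insert (\<sigma> r) (ch G (\<sigma> r))) \<le> card (D r)" for r
    by (intro card_mono D_sup nz) simp
  \<comment> \<open>One strict inequality among the terms would make the sum exceed the bound
    \<open>min\<close>.\<close>
  ultimately have "card (insert (\<sigma> r) (ch G (\<sigma> r))) = card (D r)" for r
    using min sum_strict_mono_ex1[of UNIV "\<lambda>r. card (insert (\<sigma> r) (ch G (\<sigma> r)))" "\<lambda>r. card (D r)"]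
    by (metis UNIV_I finite le_neq_implies_less not_less)
  then have D_eq: "D r = insert (\<sigma> r) (ch G (\<sigma> r))" for r
    by (intro card_subset_eq[symmetric] D_sup nz) auto
  \<comment> \<open>Any \<open>k\<close> in the support of column \<open>r\<close> has its closed
    child set inside \<open>D r\<close>, now equal to that of \<open>\<sigma> r\<close>, so
    \<open>surI\<close> applies.\<close>
  have "sur_pattern G \<sigma> H"
    unfolding sur_pattern_def using nz D_sup surI[OF G] by (metis D_eq)
  then show ?thesis
    by (rule that[OF \<sigma> _ D_eq])
qed

text \<open>Forward substitution in row \<open>k\<close> of \<open>L ** A\<close>: an off-diagonal
  term involves a smaller \<open>l\<close> surrounding \<open>k\<close>, and by induction and
  transitivity it vanishes, leaving only the pivot term.\<close>

lemma inverse_sur_pattern: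
  fixes L A :: "real^'n::{finite,wellorder}^'n::{finite,wellorder}"
  assumes G: "acyclic G" and labels: "\<And>i j. i \<in> pa G j \<Longrightarrow> i < j"
    and LA: "L ** A = mat 1" and L: "sur_pattern G id L"
  shows "A $ k $ j \<noteq> 0 \<Longrightarrow> k = j \<or> j \<in> sur G k"
proof (induction k rule: less_induct)
  case (less k)
  show ?case
  proof (rule ccontr)
    assume k: "\<not> ?case"
    have zero: "L $ k $ l * A $ l $ j = 0" if "l \<noteq> k" for l
    proof (rule ccontr)
      assume nz: "L $ k $ l * A $ l $ j \<noteq> 0"
      then have l: "l \<in> sur G k"
        using L that by (auto simp: sur_pattern_def)
      have "l < k"
        using labels l by (rule sur_less)
      then have "l = j \<or> j \<in> sur G l"
        using less nz by auto
      then show False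
        using k l sur_trans[OF _ _ G] by blast
    qed
    have "(\<Sum>l\<in>UNIV. L $ k $ l * A $ l $ j) = (L ** A) $ k $ j"
      by (simp add: matrix_matrix_mult_def)
    also have "\<dots> = 0"
      using k by (simp add: LA mat_def)
    finally have "L $ k $ k * A $ k $ j = 0"
      using zero by (simp add: sum.remove[of UNIV k])
    with L less show False
      by (simp add: sur_pattern_def)
  qed
qed

section \<open>Factorization under a linear change of variables\<close>

text \<open>Reordering the columns by \<open>\<sigma>\<close> gives a lower triangular matrix,
  because surrounding nodes have smaller labels; this changes at most the sign.\<close>

lemma det_sur_pattern:
  fixes H :: "real^'n::{finite,wellorder}^'n::{finite,wellorder}"
  assumes labels: "\<And>i j. i \<in> pa G j \<Longrightarrow> i < j"
    and \<sigma>: "bij \<sigma>" and H: "sur_pattern G \<sigma> H"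
  shows "\<bar>det H\<bar> = (\<Prod>r\<in>UNIV. \<bar>H $ \<sigma> r $ r\<bar>)"
proof -
  define L :: "real^'n::{finite,wellorder}^'n::{finite,wellorder}"
    where "L = (\<chi> k l. H $ k $ inv \<sigma> l)"
  have \<sigma>_inv: "\<sigma> (inv \<sigma> l) = l" for l
    using \<sigma> by (simp add: bij_is_surj surj_f_inv_f)
  have p: "inv \<sigma> permutes UNIV"
    using \<sigma> by (intro bij_imp_permutes) (simp_all add: bij_imp_bij_inv)
  have "L $ k $ l = 0" if "k < l" for k l
  proof (rule ccontr)
    assume "L $ k $ l \<noteq> 0"
    then have "k = l \<or> l \<in> sur G k"
      using H unfolding sur_pattern_def L_def by (metis \<sigma>_inv vec_lambda_beta)
    then show False
    proof
      assume "l \<in> sur G k"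
      from sur_less[OF labels this] that show False
        by simp
    qed (use that in simp)
  qed
  then have "det L = (\<Prod>l\<in>UNIV. L $ l $ l)"
    by (rule det_lowerdiagonal)
  also have "\<dots> = (\<Prod>r\<in>UNIV. L $ \<sigma> r $ \<sigma> r)"
    using \<sigma> by (rule prod.reindex_bij_betw[symmetric])
  also have "\<dots> = (\<Prod>r\<in>UNIV. H $ \<sigma> r $ r)"
    using \<sigma> by (simp add: L_def bij_is_inj)
  finally have "\<bar>det L\<bar> = (\<Prod>r\<in>UNIV. \<bar>H $ \<sigma> r $ r\<bar>)"
    by (simp add: abs_prod)
  moreover have "\<bar>det L\<bar> = \<bar>det H\<bar>"
    unfolding L_def det_permute_columns[OF p] by (simp add: abs_mult sign_def)
  ultimately show ?thesis
    by simp
qed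

lemma measurable_upd [measurable]: "upd z i \<in> borel_measurable borel"
proof -
  have "continuous_on UNIV (\<lambda>t. if k = i then t else z $ k)" for k
    by (cases "k = i") auto
  then have "continuous_on UNIV (upd z i)"
    unfolding upd_def by (rule continuous_on_vec_lambda)
  then show ?thesis
    by (rule borel_measurable_continuous_onI)
qed

text \<open>The pattern keeps the arguments of \<open>f\<close> within node \<open>r\<close> and its
  parents in \<open>G'\<close>, while coordinate \<open>r\<close> enters affinely with slope the
  pivot, whose absolute value restores normalization.\<close>

lemma cond_density_linear_change:
  fixes H :: "real^'n^'n"
  assumes G: "acyclic G" and \<sigma>: "bij \<sigma>" and H: "sur_pattern G \<sigma> H"
    and G': "\<And>i j. (j, i) \<in> G' \<longleftrightarrow> (\<sigma> j, \<sigma> i) \<in> G"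
    and f: "cond_density G (\<sigma> r) f"
  shows "cond_density G' r (\<lambda>w. \<bar>H $ \<sigma> r $ r\<bar> * f (H *v w))"
proof -
  define i a where "i = \<sigma> r" and "a = H $ i $ r"
  have dep: "depends_only_on (insert i (pa G i)) f" and [measurable]: "f \<in> borel_measurable borel"
    and f0: "\<And>z. 0 \<le> f z" and int: "\<And>z. (\<integral>\<^sup>+ t. ennreal (f (upd z i t)) \<partial>lborel) = 1"
    using f by (auto simp: cond_density_def i_def)
  have a: "a \<noteq> 0"
    using H by (simp add: a_def i_def sur_pattern_def)
  \<comment> \<open>If \<open>\<sigma> s\<close> surrounds \<open>k\<close>, it has \<open>k\<close>
    and all children of \<open>k\<close> as children, hence also \<open>i\<close>.\<close>
  have row: "\<sigma> s = i \<or> \<sigma> s \<in> pa G i" if "H $ k $ s \<noteq> 0" "k \<in> insert i (pa G i)" for k s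
    using H that by (auto simp: sur_pattern_def sur_def pa_def ch_def)
  have "depends_only_on (insert r (pa G' r)) (\<lambda>w. \<bar>a\<bar> * f (H *v w))"
    unfolding depends_only_on_def
  proof (intro allI impI)
    fix w w' :: "real^'n"
    assume w: "\<forall>k\<in>insert r (pa G' r). w $ k = w' $ k"
    have "(H *v w) $ k = (H *v w') $ k" if k: "k \<in> insert i (pa G i)" for k
    proof -
      have "H $ k $ s * w $ s = H $ k $ s * w' $ s" for s
        using row[OF _ k, of s] w \<sigma> by (auto simp: i_def pa_def G' bij_is_inj inj_eq)
      then show ?thesis
        unfolding matrix_vector_mult_def by (simp only: vec_lambda_beta)
    qed
    then show "\<bar>a\<bar> * f (H *v w) = \<bar>a\<bar> * f (H *v w')"
      using dep by (simp add: depends_only_on_def)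
  qed
  moreover have "(\<integral>\<^sup>+ t. ennreal (\<bar>a\<bar> * f (H *v upd w r t)) \<partial>lborel) = 1" for w
  proof -
    \<comment> \<open>\<open>b\<close> is chosen so that \<open>b + a * t\<close> is coordinate
      \<open>i\<close> of \<open>H *v upd w r t\<close>.\<close>
    define z b where "z = H *v w" and "b = z $ i - a * w $ r"
    have shift: "H *v upd w r t = z + (t - w $ r) *\<^sub>R column r H" for t
    proof -
      have "upd w r t = w + (t - w $ r) *\<^sub>R axis r 1"
        by (simp add: upd_def vec_eq_iff axis_def)
      then show ?thesis
        by (simp add: z_def matrix_vector_right_distrib scaleR_matrix_vector_assoc[symmetric]
            matrix_vector_mult_basis matrix_vector_mult_scaleR)
    qed
    \<comment> \<open>A nonzero entry would make \<open>i\<close> equal to or surround one of its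
      own parents, closing a cycle.\<close>
    have col: "H $ k $ r = 0" if "k \<in> pa G i" for k
      using H that G acyclic_childD[OF G, of i k] acyclic_childD[OF G, of k i]
      by (auto simp: sur_pattern_def i_def sur_def pa_def ch_def)
    have "f (H *v upd w r t) = f (upd z i (b + a * t))" for t
    proof -
      have "\<forall>k\<in>insert i (pa G i). (H *v upd w r t) $ k = upd z i (b + a * t) $ k"
        unfolding shift using col by (auto simp: upd_def b_def a_def column_def algebra_simps)
      then show ?thesis
        using dep by (simp add: depends_only_on_def)
    qed
    then have "(\<integral>\<^sup>+ t. ennreal (\<bar>a\<bar> * f (H *v upd w r t)) \<partial>lborel)
        = \<bar>a\<bar> * (\<integral>\<^sup>+ t. ennreal (f (upd z i (b + a * t))) \<partial>lborel)"
      by (simp add: ennreal_mult' nn_integral_cmult)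
    also have "\<dots> = (\<integral>\<^sup>+ t. ennreal (f (upd z i t)) \<partial>lborel)"
      using a by (intro nn_integral_real_affine[symmetric]) measurable
    finally show ?thesis
      by (simp add: int)
  qed
  ultimately show ?thesis
    using f0 by (simp add: cond_density_def i_def a_def)
qed

text \<open>The Jacobian factor is a product of pivots, so each conditional density can absorb its
  own pivot.\<close>

lemma factorizes_linear_change:
  fixes A H :: "real^'n::{finite,wellorder}^'n::{finite,wellorder}"
  assumes G: "acyclic G" and labels: "\<And>i j. i \<in> pa G j \<Longrightarrow> i < j"
    and \<sigma>: "bij \<sigma>" and H: "sur_pattern G \<sigma> H" and AH: "A ** H = mat 1"
    and G': "\<And>i j. (j, i) \<in> G' \<longleftrightarrow> (\<sigma> j, \<sigma> i) \<in> G"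
    and f: "\<And>i. cond_density G i (f i)"
    and Z: "distributed M lborel Z (\<lambda>z. ennreal (\<Prod>i\<in>UNIV. f i z))"
    and Y: "\<And>\<omega>. \<omega> \<in> space M \<Longrightarrow> Y \<omega> = A *v Z \<omega>"
  shows "factorizes G' M Y"
proof -
  have "(\<Prod>r\<in>UNIV. \<bar>H $ \<sigma> r $ r\<bar> * f (\<sigma> r) (H *v w)) = \<bar>det H\<bar> * (\<Prod>i\<in>UNIV. f i (H *v w))" for w
    by (simp add: prod.distrib det_sur_pattern[OF labels \<sigma> H]
        prod.reindex_bij_betw[OF \<sigma>, of "\<lambda>i. f i (H *v w)"])
  then have "distributed M lborel (\<lambda>\<omega>. A *v Z \<omega>)
      (\<lambda>w. ennreal (\<Prod>r\<in>UNIV. \<bar>H $ \<sigma> r $ r\<bar> * f (\<sigma> r) (H *v w)))"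
    using distributed_matrix[OF AH Z] by (simp add: ennreal_mult')
  moreover have "distr M lborel Y = distr M lborel (\<lambda>\<omega>. A *v Z \<omega>)"
    by (intro distr_cong) (auto simp: Y)
  moreover have "Y \<in> measurable M lborel \<longleftrightarrow> (\<lambda>\<omega>. A *v Z \<omega>) \<in> measurable M lborel"
    by (intro measurable_cong) (auto simp: Y)
  ultimately have "distributed M lborel Y
      (\<lambda>w. ennreal (\<Prod>r\<in>UNIV. \<bar>H $ \<sigma> r $ r\<bar> * f (\<sigma> r) (H *v w)))"
    by (simp add: distributed_def)
  then show ?thesis
    unfolding factorizes_def using cond_density_linear_change[OF G \<sigma> H G' f]
    by (intro exI[of _ "\<lambda>r w. \<bar>H $ \<sigma> r $ r\<bar> * f (\<sigma> r) (H *v w)"]) auto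
qed

section \<open>Identification from score changes\<close>

text \<open>Columns of a score change matrix are environments; \<open>m\<close> turns them into
  intervened nodes, so that row counts can be compared with child sets.\<close>

lemma norm0_reindex:
  fixes A :: "real^'n^'k"
  assumes "bij m"
  shows "norm0 A = (\<Sum>r\<in>UNIV. card {i. A $ r $ m i \<noteq> 0})"
proof -
  have "norm0 A = card (SIGMA r:UNIV. {j. A $ r $ j \<noteq> 0})"
    unfolding norm0_def by (rule arg_cong[of _ _ card]) auto
  also have "\<dots> = (\<Sum>r\<in>UNIV. card {j. A $ r $ j \<noteq> 0})"
    by (intro card_SigmaI) auto
  also have "\<dots> = (\<Sum>r\<in>UNIV. card {i. A $ r $ m i \<noteq> 0})"
  proof (intro sum.cong refl bij_betw_same_card[symmetric])
    show "bij_betw m {i. A $ r $ m i \<noteq> 0} {j. A $ r $ j \<noteq> 0}" for r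
      using assms by (auto simp: bij_betw_def inj_on_def bij_def surj_def image_iff)
  qed
  finally show ?thesis .
qed

text \<open>One product formula lets all environments be treated uniformly.\<close>

lemma latent_density_eq_prod:
  assumes "bij m"
  shows "latent_density p q m e z = (\<Prod>j\<in>UNIV. (if e = Interv (m j) then q j else p j) z)"
proof (cases e)
  case (Interv k)
  define i where "i = inv m k"
  have i: "k = m j \<longleftrightarrow> j = i" for j
    using assms by (auto simp: i_def bij_inv_eq_iff)
  show ?thesis
    by (simp add: Interv i prod.remove[of UNIV i] i_def[symmetric])
qed simp

text \<open>Write \<open>\<tau> s = \<sigma> r\<close>. If \<open>r < s\<close>, induction gives
  \<open>\<tau> r = \<sigma> r = \<tau> s\<close>, against injectivity; so
  \<open>r = s\<close>.\<close>

lemma bij_eq_if_le: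
  fixes \<sigma> \<tau> :: "'n::{finite,wellorder} \<Rightarrow> 'a"
  assumes \<sigma>: "bij \<sigma>" and \<tau>: "bij \<tau>" and le: "\<And>r s. \<tau> s = \<sigma> r \<Longrightarrow> r \<le> s"
  shows "\<tau> = \<sigma>"
proof
  fix s
  show "\<tau> s = \<sigma> s"
  proof (induction s rule: less_induct)
    case (less s)
    obtain r where r: "\<tau> s = \<sigma> r"
      using \<sigma> by (metis bij_pointE)
    have "\<not> r < s"
      using less r \<tau> by (metis bij_is_inj injD less_irrefl)
    with le[OF r] r show ?case
      by simp
  qed
qed

theorem theorem2:
  fixes T :: "real^'n::{finite,wellorder}^'d"
    and G :: "('n \<times> 'n) set"
    and p q :: "'n \<Rightarrow> real^'n::{finite,wellorder} \<Rightarrow> real"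
    and m :: "'n \<Rightarrow> 'n"
    and M :: "'n environment \<Rightarrow> 'w measure"
    and Z :: "'n environment \<Rightarrow> 'w \<Rightarrow> real^'n::{finite,wellorder}"
    and X :: "'n environment \<Rightarrow> 'w \<Rightarrow> real^'d"
    and pZ :: "'n environment \<Rightarrow> real^'n::{finite,wellorder} \<Rightarrow> real"
    and pX :: "'n environment \<Rightarrow> real^'d \<Rightarrow> real"
    and sZ :: "'n environment \<Rightarrow> real^'n::{finite,wellorder} \<Rightarrow> real^'n::{finite,wellorder}"
    and sX :: "'n environment \<Rightarrow> real^'d \<Rightarrow> real^'d"
    and \<Delta> :: "real^'d^'n::{finite,wellorder} \<Rightarrow> real^'n::{finite,wellorder}^'n::{finite,wellorder}"
    and That :: "real^'n::{finite,wellorder}^'d"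
    and Zhat :: "'n environment \<Rightarrow> 'w \<Rightarrow> real^'n::{finite,wellorder}"
    and P2 K :: "real^'n::{finite,wellorder}^'n::{finite,wellorder}"
    and Ghat :: "('n \<times> 'n) set"
  assumes dims: "CARD('n) \<le> CARD('d)"
    and rank_T: "rank T = CARD('n)"
    and dag: "acyclic G"
    and labels: "\<And>i j. i \<in> pa G j \<Longrightarrow> i < j"
    and cond_p: "\<And>i. cond_density G i (p i)"
    and cond_q: "\<And>i. cond_density G i (q i)"
    and q_neq_p: "\<And>i. q i \<noteq> p i"
    and pos: "\<And>i z. p i z > 0" "\<And>i z. q i z > 0"
    and smooth: "\<And>i. C1_function (p i)" "\<And>i. C1_function (q i)"
    \<comment> \<open>(A1) and the laws of the latent and observed vectors\<close>
    and A1: "bij m"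
    and pZ: "pZ = latent_density p q m"
    and prob: "\<And>e. prob_space (M e)"
    and law_Z: "\<And>e. distributed (M e) lborel (Z e) (\<lambda>z. ennreal (pZ e z))"
    and X: "\<And>e \<omega>. \<omega> \<in> space (M e) \<Longrightarrow> X e \<omega> = T *v Z e \<omega>"
    and law_X: "\<And>e. distributed (M e) (lebesgue_im T) (X e) (\<lambda>x. ennreal (pX e x))"
    and cont_pX: "\<And>e. continuous_on (im T) (pX e)"
    \<comment> \<open>scores\<close>
    and sZ: "\<And>e. sZ e = score_along UNIV (pZ e)"
    and sX: "\<And>e. sX e = score_along (im T) (pX e)"
    \<comment> \<open>(A2) and (A3)\<close>
    and A2: "\<And>i k. k \<in> pa G i \<Longrightarrow> \<exists>z. partial_deriv k (\<lambda>z. q i z / p i z) z \<noteq> 0"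
    and A3: "\<And>i c. \<exists>j\<in>insert i (pa G i). c $ j \<noteq> 0 \<Longrightarrow>
               \<not> (AE \<omega> in M Obs. c \<bullet> sZ Obs (Z Obs \<omega>) = c \<bullet> sZ (Interv (m i)) (Z Obs \<omega>))"
    \<comment> \<open>the estimates\<close>
    and \<Delta>: "\<Delta> = score_change (M Obs) (X Obs) sX"
    and That: "That \<in> candidatesS T \<Delta>"
    and Zhat: "\<And>e \<omega>. \<omega> \<in> space (M e) \<Longrightarrow> Zhat e \<omega> = pinv That *v X e \<omega>"
    and P2: "P2 \<in> perm_matrices"
    and K: "K = \<Delta> (transpose That) ** P2" "upper_triangular K"
    and Ghat: "Ghat = graph_of_matrix K"
  shows "\<exists>\<pi>. valid_causal_order G \<pi> \<and>
           (acyclic Ghat \<and>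
            (\<forall>i j. (j, i) \<in> Ghat \<longleftrightarrow> (\<pi> j, \<pi> i) \<in> G) \<and>
            (\<forall>e. factorizes Ghat (M e) (Zhat e))) \<and>
           (\<exists>C B. diagonal_matrix C \<and>
                  (\<forall>i j. j \<notin> sur G i \<longrightarrow> B $ i $ j = 0) \<and>
                  (\<forall>e. \<forall>\<omega>\<in>space (M e).
                     Zhat e \<omega> = (perm_matrix \<pi> ** (C + B)) *v Z e \<omega>))"
proof -

  \<comment> \<open>Score changes of a candidate\<close>
  define F where "F e j = (if e = Interv (m j) then q j else p j)" for e j
  have F_cond: "cond_density G j (F e j)" and F_pos: "0 < F e j z" and F_C1: "C1_function (F e j)" for e j z
    using cond_p cond_q pos smooth by (auto simp: F_def)
  have pZ_eq: "pZ e = (\<lambda>z. \<Prod>j\<in>UNIV. F e j z)" for e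
    by (simp add: pZ fun_eq_iff latent_density_eq_prod[OF A1] F_def)
  have pZ_pos: "0 < pZ e z" for e z
    using F_pos by (simp add: pZ_eq prod_pos)
  have sZ_eq: "sZ e z = (\<Sum>j\<in>UNIV. score_along UNIV (F e j) z)" for e z
    using score_along_prod[of "F e" z] F_C1 F_pos by (simp add: sZ pZ_eq)
  have pZ_cont: "continuous_on UNIV (pZ e)" for e
    unfolding pZ_eq by (intro continuous_on_prod C1_function_continuous_on F_C1)
  \<comment> \<open>The constant factor between the two densities disappears in the gradient of the
    logarithm.\<close>
  have sX_eq: "transpose T *v sX e (T *v z) = sZ e z" for e z
  proof -
    obtain c where c: "0 < c" "\<And>z. pX e (T *v z) = c * pZ e z"
      using density_on_image[OF prob rank_T law_Z pZ_pos pZ_cont X law_X cont_pX] by blast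
    have "((\<lambda>z. ln (pZ e z)) has_derivative (\<lambda>h. h \<bullet> sZ e z)) (at z)"
      using ln_prod_has_derivative_score[of "F e" z] F_C1 F_pos by (simp add: sZ_eq pZ_eq)
    from score_along_image[OF rank_T c pZ_pos this] show ?thesis
      by (simp add: sX)
  qed
  \<comment> \<open>One direction is (A3). Conversely, only the factor of \<open>i\<close> changes,
    and both its versions depend only on coordinates where \<open>c\<close> vanishes.\<close>
  have score_diff: "(AE \<omega> in M Obs. c \<bullet> sZ Obs (Z Obs \<omega>) = c \<bullet> sZ (Interv (m i)) (Z Obs \<omega>))
      \<longleftrightarrow> (\<forall>k\<in>insert i (pa G i). c $ k = 0)" for c i
  proof
    assume "AE \<omega> in M Obs. c \<bullet> sZ Obs (Z Obs \<omega>) = c \<bullet> sZ (Interv (m i)) (Z Obs \<omega>)"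
    then show "\<forall>k\<in>insert i (pa G i). c $ k = 0"
      using A3 by blast
  next
    assume c: "\<forall>k\<in>insert i (pa G i). c $ k = 0"
    have "c \<bullet> score_along UNIV (F Obs j) z = c \<bullet> score_along UNIV (F (Interv (m i)) j) z" for j z
    proof (cases "j = i")
      case True
      have "c \<bullet> score_along UNIV (F e i) z = 0" for e
        using F_cond[of i e] c by (intro score_along_depends_only_on[OF F_C1 F_pos]) (auto simp: cond_density_def)
      then show ?thesis
        by (simp add: True)
    next
      case False
      then show ?thesis
        using A1 by (simp add: F_def bij_is_inj inj_eq)
    qed
    then show "AE \<omega> in M Obs. c \<bullet> sZ Obs (Z Obs \<omega>) = c \<bullet> sZ (Interv (m i)) (Z Obs \<omega>)"
      by (simp add: sZ_eq inner_sum_right)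
  qed
  \<comment> \<open>Row \<open>r\<close> of the transformed score is column \<open>r\<close> of
    \<open>H\<close> paired with the latent score, so \<open>score_diff\<close> decides the
    entry.\<close>
  have \<Delta>_eq: "\<Delta> (transpose (T ** H)) $ r $ m i = (if \<exists>k\<in>insert i (pa G i). H $ k $ r \<noteq> 0 then 1 else 0)"
    for H r i
  proof -
    have "(transpose (T ** H) *v sX e (X Obs \<omega>)) $ r = column r H \<bullet> sZ e (Z Obs \<omega>)"
      if "\<omega> \<in> space (M Obs)" for e \<omega>
    proof -
      have "transpose (T ** H) *v sX e (X Obs \<omega>) = transpose H *v sZ e (Z Obs \<omega>)"
        by (simp only: X[OF that] matrix_transpose_mul sX_eq flip: matrix_vector_mul_assoc)
      then show ?thesis
        by (simp add: matrix_vector_mul_component row_transpose column_def transpose_def)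
    qed
    then have "(AE \<omega> in M Obs. (transpose (T ** H) *v sX Obs (X Obs \<omega>)) $ r
          = (transpose (T ** H) *v sX (Interv (m i)) (X Obs \<omega>)) $ r)
        \<longleftrightarrow> (\<forall>k\<in>insert i (pa G i). column r H $ k = 0)"
      unfolding score_diff[symmetric] by (intro AE_cong) simp
    then show ?thesis
      by (auto simp: \<Delta> score_change_def column_def)
  qed

  \<comment> \<open>The estimate as an invertible transform of the latent vector\<close>
  define A where "A = pinv That ** T"
  have That_min: "That \<in> candidates1 T \<Delta>"
    using That by (simp add: candidatesS_def)
  then have "That \<in> candidates T"
    by (simp add: candidates1_def is_arg_min_def)
  \<comment> \<open>\<open>That ** pinv That\<close> fixes every vector of
    \<open>im T\<close>.\<close>
  then have T_eq: "T = That ** A"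
    by (auto simp: candidates_def A_def matrix_eq simp flip: matrix_vector_mul_assoc)
  have "inj ((*v) T)"
    using rank_T by (simp add: full_rank_injective)
  then obtain T' where "T' ** T = mat 1"
    unfolding matrix_left_invertible_injective[symmetric] by blast
  then have "(T' ** That) ** A = mat 1"
    by (metis T_eq matrix_mul_assoc)
  then obtain H where HA: "H ** A = mat 1"
    by blast
  then have AH: "A ** H = mat 1"
    by (simp add: matrix_left_right_inverse)
  have That_eq: "That = T ** H"
    by (metis T_eq AH matrix_mul_assoc matrix_mul_rid)
  have "det H \<noteq> 0"
    using arg_cong[OF HA, of det] by (auto simp: det_mul)

  \<comment> \<open>Minimality and the resulting support pattern\<close>
  define D where "D r = {i. \<exists>k\<in>insert i (pa G i). H $ k $ r \<noteq> 0}" for r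
  \<comment> \<open>\<open>T\<close> itself, with \<open>H\<close> the identity, is the competitor
    whose count is the total size of the closed child sets.\<close>
  have "T \<in> candidates T"
    using rank_T
    by (auto simp: candidates_def matrix_vector_mul_assoc pinv_left_inverse simp flip: matrix_mul_assoc)
  then have "norm0 (\<Delta> (transpose That)) \<le> norm0 (\<Delta> (transpose T))"
    using That_min by (force simp: candidates1_def is_arg_min_def)
  moreover have "norm0 (\<Delta> (transpose That)) = (\<Sum>r\<in>UNIV. card (D r))"
    by (simp add: norm0_reindex[OF A1] That_eq \<Delta>_eq D_def)
  moreover have "norm0 (\<Delta> (transpose T)) = (\<Sum>k\<in>UNIV. card (insert k (ch G k)))"
  proof -
    have "{i. \<exists>k\<in>insert i (pa G i). (mat 1 :: real^'n::{finite,wellorder}^'n::{finite,wellorder}) $ k $ r \<noteq> 0}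
        = insert r (ch G r)" for r
      by (auto simp: mat_def pa_def ch_def)
    then show ?thesis
      using \<Delta>_eq[of "mat 1"] by (simp add: norm0_reindex[OF A1])
  qed
  ultimately have D_le: "(\<Sum>r\<in>UNIV. card (D r)) \<le> (\<Sum>k\<in>UNIV. card (insert k (ch G k)))"
    by simp
  have D_iff: "i \<in> D r \<longleftrightarrow> (\<exists>k\<in>insert i (pa G i). H $ k $ r \<noteq> 0)" for i r
    by (simp add: D_def)
  obtain \<sigma> where \<sigma>: "bij \<sigma>" and H: "sur_pattern G \<sigma> H"
    and D_eq: "\<And>r. D r = insert (\<sigma> r) (ch G (\<sigma> r))"
    by (rule minimal_pattern[OF dag \<open>det H \<noteq> 0\<close> D_iff D_le]) blast

  \<comment> \<open>Column permutation, graph and causal order\<close>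
  obtain \<rho> where \<rho>: "bij \<rho>" "P2 = perm_matrix \<rho>"
    using P2 by (auto simp: perm_matrices_def)
  \<comment> \<open>\<open>\<tau> s\<close> is the node intervened in the environment that
    \<open>P2\<close> places in column \<open>s\<close>.\<close>
  define \<tau> where "\<tau> = inv m \<circ> inv \<rho>"
  have \<tau>: "bij \<tau>"
    using \<rho> A1 by (simp add: \<tau>_def bij_comp bij_imp_bij_inv)
  have K_eq: "K $ r $ s = (if \<tau> s \<in> insert (\<sigma> r) (ch G (\<sigma> r)) then 1 else 0)" for r s
  proof -
    have "s = \<rho> t \<longleftrightarrow> t = m (\<tau> s)" for t
      using \<rho>(1) A1 by (auto simp: \<tau>_def bij_inv_eq_iff bij_is_surj surj_f_inv_f)
    then have "K $ r $ s = \<Delta> (transpose That) $ r $ m (\<tau> s)"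
      by (simp add: K(1) \<rho>(2) matrix_matrix_mult_def perm_matrix_def if_distrib[of "\<lambda>x. _ * x"] cong: if_cong)
    then show ?thesis
      by (simp add: That_eq \<Delta>_eq D_eq[symmetric] D_def)
  qed
  have upper: "r \<le> s" if "\<tau> s \<in> insert (\<sigma> r) (ch G (\<sigma> r))" for r s
    using K(2) K_eq[of r s] that by (auto simp: upper_triangular_def not_less[symmetric])
  \<comment> \<open>If \<open>\<tau> s = \<sigma> r\<close>, then \<open>K\<close> has a 1 in row
    \<open>r\<close>, column \<open>s\<close>, and triangularity yields
    \<open>r \<le> s\<close>.\<close>
  have \<tau>\<sigma>: "\<tau> = \<sigma>"
    using upper by (intro bij_eq_if_le[OF \<sigma> \<tau>]) auto
  \<comment> \<open>The diagonal ones of \<open>K\<close> are dropped by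
    \<open>graph_of_matrix\<close>, and acyclicity excludes loops in \<open>G\<close>.\<close>
  have Ghat_iff: "(j, i) \<in> Ghat \<longleftrightarrow> (\<sigma> j, \<sigma> i) \<in> G" for i j
    using acyclic_childD(1)[OF dag, of "\<sigma> i" "\<sigma> j"] \<sigma>
    by (auto simp: Ghat graph_of_matrix_def K_eq \<tau>\<sigma> ch_def bij_is_inj inj_eq)
  have order: "j < i" if "(\<sigma> j, \<sigma> i) \<in> G" for i j
    using upper[of i j] that acyclic_childD(1)[OF dag, of "\<sigma> i" "\<sigma> j"]
    by (auto simp: \<tau>\<sigma> ch_def order_less_le)
  then have valid: "valid_causal_order G \<sigma>"
    using \<sigma> by (auto simp: valid_causal_order_def pa_def)
  have "acyclic Ghat"
    using order Ghat_iff by (intro acyclic_subset[OF wf_acyclic[OF wf]]) auto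

  \<comment> \<open>Factorization in every environment\<close>
  have fact: "factorizes Ghat (M e) (Zhat e)" for e
  proof (rule factorizes_linear_change[OF dag labels \<sigma> H AH Ghat_iff])
    show "distributed (M e) lborel (Z e) (\<lambda>z. ennreal (\<Prod>i\<in>UNIV. F e i z))"
      using law_Z[of e] by (simp add: pZ_eq)
    show "Zhat e \<omega> = A *v Z e \<omega>" if "\<omega> \<in> space (M e)" for \<omega>
      using that by (simp add: Zhat X A_def matrix_vector_mul_assoc)
  qed (use labels F_cond in auto)

  \<comment> \<open>Mixing consistency\<close>
  define S where "S = (\<chi> k j. A $ inv \<sigma> k $ j)"
  define L where "L = (\<chi> k l. H $ k $ inv \<sigma> l)"
  have \<sigma>_inv: "\<sigma> (inv \<sigma> k) = k" "inv \<sigma> (\<sigma> k) = k" for k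
    using \<sigma> by (simp_all add: bij_is_surj surj_f_inv_f bij_is_inj)
  \<comment> \<open>Indexing the rows of \<open>A\<close> and the columns of \<open>H\<close> by
    nodes only reorders the summation, so the matrices stay inverse to each other.\<close>
  have "(L ** S) $ k $ j = (H ** A) $ k $ j" for k j
    using sum.reindex_bij_betw[OF bij_imp_bij_inv[OF \<sigma>], of "\<lambda>r. H $ k $ r * A $ r $ j"]
    by (simp add: L_def S_def matrix_matrix_mult_def)
  then have LS: "L ** S = mat 1"
    by (simp add: vec_eq_iff HA)
  have S_pattern: "k = j \<or> j \<in> sur G k" if "S $ k $ j \<noteq> 0" for k j
  proof (rule inverse_sur_pattern[OF dag labels LS _ that])
    have H': "H $ \<sigma> r $ r \<noteq> 0" "H $ k $ r \<noteq> 0 \<Longrightarrow> k = \<sigma> r \<or> \<sigma> r \<in> sur G k" for k r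
      using H by (simp_all add: sur_pattern_def)
    have "L $ k $ k \<noteq> 0" for k
      using H'(1)[of "inv \<sigma> k"] by (simp add: L_def \<sigma>_inv)
    moreover have "k = l \<or> l \<in> sur G k" if "L $ k $ l \<noteq> 0" for k l
      using H'(2)[of k "inv \<sigma> l"] that by (simp add: L_def \<sigma>_inv)
    ultimately show "sur_pattern G id L"
      by (simp add: sur_pattern_def)
  qed
  \<comment> \<open>Split off the diagonal of \<open>S\<close>; by \<open>S_pattern\<close> the
    remainder lives on surrounding nodes.\<close>
  define C where "C = (\<chi> k j. if k = j then S $ k $ j else 0)"
  define B where "B = S - C"
  have "diagonal_matrix C"
    by (simp add: diagonal_matrix_def C_def)
  moreover have "B $ i $ j = 0" if "j \<notin> sur G i" for i j
    using S_pattern[of i j] that by (auto simp: B_def C_def)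
  \<comment> \<open>Row \<open>r\<close> of the product is row \<open>\<sigma> r\<close> of
    \<open>S\<close>, which is row \<open>r\<close> of \<open>A\<close>.\<close>
  moreover have "perm_matrix \<sigma> ** (C + B) = A"
    by (simp add: B_def S_def vec_eq_iff matrix_matrix_mult_def perm_matrix_def \<sigma>_inv
        if_distrib[of "\<lambda>x. x * _"] cong: if_cong)
  then have "\<forall>e. \<forall>\<omega>\<in>space (M e). Zhat e \<omega> = (perm_matrix \<sigma> ** (C + B)) *v Z e \<omega>"
    by (simp add: Zhat X A_def matrix_vector_mul_assoc)
  ultimately show ?thesis
    using valid \<open>acyclic Ghat\<close> Ghat_iff fact by blast
qed

end
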